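(* Let $S\subset(0,+\infty)$ be countable with $0$ an accumulation point of $S$. Then the completion $\mathbf{U}_S$ of the ultrametric space $\mathbf{Q}_S$ is (isometric to) the ultrametric space whose underlying set is the set of all $x\in\mathbb{Q}^S$ for which there is a strictly decreasing sequence $(s_i)_{i\in\omega}$ of elements of $S$ converging to $0$ such that the support of $x$ is contained in $\{s_i:i\in\omega\}$, with distance $d(x,y)=\min\{s\in S:\forall t\in S\,(s<t\Rightarrow x(t)=y(t))\}$ for $x\ne y$.
   Context: $\mathbf{Q}_S$ is the set of finitely supported functions $x:S\to\mathbb{Q}$ with the ultrametric $d(x,y)=\min\{s\in S:\forall t\in S\,(s<t\Rightarrow x(t)=y(t))\}$ for $x\neq y$, $d(x,x)=0$; it is naturally a subset of the space described in the claim. *)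

theory Defs
  imports "HOL-Analysis.Analysis"
begin

definition supp_on :: "real set \<Rightarrow> (real \<Rightarrow> rat) \<Rightarrow> real set" where
  "supp_on S x = {s \<in> S. x s \<noteq> 0}"

text \<open>
  Functions from S to the rationals are represented by the extensional function space
  \<open>S \<rightarrow>\<^sub>E UNIV\<close>, so that equality of functions is equality on S.
\<close>

definition Q_carrier :: "real set \<Rightarrow> (real \<Rightarrow> rat) set" where
  "Q_carrier S = {x \<in> S \<rightarrow>\<^sub>E UNIV. finite (supp_on S x)}"

definition U_carrier :: "real set \<Rightarrow> (real \<Rightarrow> rat) set" where
  "U_carrier S = {x \<in> S \<rightarrow>\<^sub>E UNIV.
     \<exists>\<sigma> :: nat \<Rightarrow> real. range \<sigma> \<subseteq> S \<and> strict_antimono_on UNIV \<sigma> \<and> \<sigma> \<longlonglongrightarrow> 0 \<and>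
       supp_on S x \<subseteq> range \<sigma>}"

text \<open>
  The minimum is rendered by \<open>LEAST\<close>, which is meaningful only when a least element exists;
  this is the case for distinct points of \<open>Q_carrier S\<close> or \<open>U_carrier S\<close>
  (the largest \<open>s \<in> S\<close> with \<open>x s \<noteq> y s\<close>).
\<close>

definition sep_dist :: "real set \<Rightarrow> (real \<Rightarrow> rat) \<Rightarrow> (real \<Rightarrow> rat) \<Rightarrow> real" where
  "sep_dist S x y =
     (if x = y then 0 else (LEAST s. s \<in> S \<and> (\<forall>t\<in>S. s < t \<longrightarrow> x t = y t)))"

text \<open>
  The locale \<^locale>\<open>Metric_space\<close> requires nonnegativity and symmetry also for arguments outside
  the carrier, so distances are set to 0 there.
\<close>

definition dist_on :: "'a set \<Rightarrow> ('a \<Rightarrow> 'a \<Rightarrow> real) \<Rightarrow> 'a \<Rightarrow> 'a \<Rightarrow> real" where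
  "dist_on M d x y = (if x \<in> M \<and> y \<in> M then d x y else 0)"

definition Q_dist :: "real set \<Rightarrow> (real \<Rightarrow> rat) \<Rightarrow> (real \<Rightarrow> rat) \<Rightarrow> real" where
  "Q_dist S = dist_on (Q_carrier S) (sep_dist S)"

definition U_dist :: "real set \<Rightarrow> (real \<Rightarrow> rat) \<Rightarrow> (real \<Rightarrow> rat) \<Rightarrow> real" where
  "U_dist S = dist_on (U_carrier S) (sep_dist S)"

locale Ultrametric_space = Metric_space +
  assumes ultrametric: "\<lbrakk>x \<in> M; y \<in> M; z \<in> M\<rbrakk> \<Longrightarrow> d x z \<le> max (d x y) (d y z)"

definition isometric_embedding ::
  "'a set \<Rightarrow> ('a \<Rightarrow> 'a \<Rightarrow> real) \<Rightarrow> 'b set \<Rightarrow> ('b \<Rightarrow> 'b \<Rightarrow> real) \<Rightarrow> ('a \<Rightarrow> 'b) \<Rightarrow> bool" where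
  "isometric_embedding M d N e f \<longleftrightarrow>
     f \<in> M \<rightarrow> N \<and> (\<forall>x\<in>M. \<forall>y\<in>M. e (f x) (f y) = d x y)"

definition is_completion ::
  "'a set \<Rightarrow> ('a \<Rightarrow> 'a \<Rightarrow> real) \<Rightarrow> 'b set \<Rightarrow> ('b \<Rightarrow> 'b \<Rightarrow> real) \<Rightarrow> ('a \<Rightarrow> 'b) \<Rightarrow> bool" where
  "is_completion M d N e f \<longleftrightarrow>
     Metric_space M d \<and> Metric_space N e \<and> Metric_space.mcomplete N e \<and>
     isometric_embedding M d N e f \<and>
     Metric_space.mtopology N e closure_of (f ` M) = N"

end

theory Submission
  imports Defs
begin

text \<open>
  A function on \<open>S\<close> belongs to \<open>U_carrier S\<close> iff its support is \<^emph>\<open>locally finite\<close>: only finitely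
  many points of the support exceed any given \<open>\<epsilon> > 0\<close>.  The point 0 being a limit point of \<open>S\<close>
  makes it possible to enlarge a finite support to the range of a sequence.  Moreover, \<open>sep_dist S x y \<le> r\<close>
  means that \<open>x\<close> and \<open>y\<close> agree above \<open>r\<close>; so a Cauchy sequence is eventually constant above each
  \<open>\<epsilon>\<close>, its pointwise limit has locally finite support, and truncating a point of \<open>U_carrier S\<close>
  below \<open>\<epsilon>\<close> gives a finitely supported \<open>\<epsilon>\<close>-approximation.
\<close>

section \<open>Locally finite sets of positive reals\<close>

text \<open>For sets of positive reals this keeps what matters about lying in the range of a
  sequence that decreases to 0, but forgets the sequence. In this form closure under subsets and
  unions is immediate.\<close>

definition locally_finite_pos :: "real set \<Rightarrow> bool" where
  "locally_finite_pos A \<longleftrightarrow> (\<forall>\<epsilon>>0. finite {a \<in> A. \<epsilon> < a})"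

lemma locally_finite_posD: "locally_finite_pos A \<Longrightarrow> 0 < \<epsilon> \<Longrightarrow> finite {a \<in> A. \<epsilon> < a}"
  by (simp add: locally_finite_pos_def)

lemma locally_finite_pos_subset: "locally_finite_pos B \<Longrightarrow> A \<subseteq> B \<Longrightarrow> locally_finite_pos A"
  unfolding locally_finite_pos_def by (blast intro: finite_subset[rotated])

lemma locally_finite_pos_Un:
  assumes "locally_finite_pos A" "locally_finite_pos B"
  shows "locally_finite_pos (A \<union> B)"
proof -
  have "{a \<in> A \<union> B. \<epsilon> < a} = {a \<in> A. \<epsilon> < a} \<union> {a \<in> B. \<epsilon> < a}" for \<epsilon> by auto
  then show ?thesis using assms by (simp add: locally_finite_pos_def)
qed

lemma finite_imp_locally_finite_pos: "finite A \<Longrightarrow> locally_finite_pos A"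
  by (simp add: locally_finite_pos_def)

lemma locally_finite_pos_range:
  fixes \<sigma> :: "nat \<Rightarrow> real"
  assumes "\<sigma> \<longlonglongrightarrow> 0"
  shows "locally_finite_pos (range \<sigma>)"
  unfolding locally_finite_pos_def
proof (intro allI impI)
  fix \<epsilon> :: real assume "\<epsilon> > 0"
  then have "\<forall>\<^sub>F n in sequentially. \<sigma> n < \<epsilon>"
    using assms by (intro order_tendstoD)
  then obtain k where k: "\<And>n. n \<ge> k \<Longrightarrow> \<sigma> n < \<epsilon>"
    by (auto simp: eventually_sequentially)
  have "{a \<in> range \<sigma>. \<epsilon> < a} \<subseteq> \<sigma> ` {..<k}"
    using k by (force simp: not_le[symmetric])
  then show "finite {a \<in> range \<sigma>. \<epsilon> < a}"
    by (rule finite_subset) simp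
qed

text \<open>Supplies padding for finite supports. Any sequence in \<open>S\<close> tending to 0 will
  do: if its range were finite, its terms would eventually drop below the positive minimum of that
  range.\<close>

lemma islimpt_0_infinite_locally_finite_pos:
  assumes "S \<subseteq> {0<..}" "0 islimpt S"
  obtains B where "B \<subseteq> S" "infinite B" "locally_finite_pos B"
proof -
  obtain \<tau> where \<tau>: "\<And>n. \<tau> n \<in> S - {0}" "\<tau> \<longlonglongrightarrow> 0"
    using assms(2) unfolding islimpt_sequential by blast
  have "infinite (range \<tau>)"
  proof
    assume fin: "finite (range \<tau>)"
    have "0 < Min (range \<tau>)"
      using fin \<tau>(1) assms(1) by (subst Min_gr_iff) auto
    then have "\<forall>\<^sub>F n in sequentially. \<tau> n < Min (range \<tau>)"
      using \<tau>(2) by (intro order_tendstoD)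
    then obtain n where "\<tau> n < Min (range \<tau>)"
      by (auto simp: eventually_sequentially)
    moreover have "Min (range \<tau>) \<le> \<tau> n"
      using fin by simp
    ultimately show False by simp
  qed
  with \<tau> show thesis
    by (intro that[of "range \<tau>"] locally_finite_pos_range) auto
qed

text \<open>Only finitely many elements exceed half of a given element, and the largest of these
  dominates the rest. Applied to the set where two functions differ, this makes their distance a
  genuine minimum.\<close>

lemma locally_finite_pos_greatest:
  assumes "locally_finite_pos A" "A \<subseteq> {0<..}" "A \<noteq> {}"
  obtains m where "m \<in> A" "\<And>a. a \<in> A \<Longrightarrow> a \<le> m"
proof -
  obtain a where a: "a \<in> A" using assms(3) by blast
  \<comment> \<open>The bound is halved because the inequality is strict and \<open>a\<close> itself
    has to belong to \<open>?F\<close>.\<close>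
  let ?F = "{b \<in> A. a / 2 < b}"
  have "0 < a" using a assms(2) by auto
  then have F: "finite ?F" "a \<in> ?F"
    using a locally_finite_posD[OF assms(1), of "a / 2"] by auto
  then have "Max ?F \<in> ?F" by (metis Max_in empty_iff)
  moreover have "b \<le> Max ?F" if "b \<in> A" for b
  proof (cases "a / 2 < b")
    case True
    then show ?thesis using that F(1) by simp
  next
    case False
    moreover have "a \<le> Max ?F" using F by (intro Max_ge)
    ultimately show ?thesis using \<open>0 < a\<close> by linarith
  qed
  ultimately show thesis using that by blast
qed

text \<open>List \<open>B\<close> from the top, each term being the greatest element below the
  previous one. Infinitude provides a next term; local finiteness forces the terms to 0, so no
  element is skipped.\<close>

lemma locally_finite_pos_enumerate:
  assumes lf: "locally_finite_pos B" and pos: "B \<subseteq> {0<..}" and inf: "infinite B"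
  obtains \<sigma> :: "nat \<Rightarrow> real"
    where "range \<sigma> = B" "strict_antimono_on UNIV \<sigma>" "\<sigma> \<longlonglongrightarrow> 0"
proof -
  \<comment> \<open>\<open>?P\<close> fixes only the start, the greatest element of
    \<open>B\<close>; \<open>?Q\<close> makes \<open>y\<close> the immediate predecessor of
    \<open>x\<close> in \<open>B\<close>.\<close>
  let ?P = "\<lambda>(n::nat) x. x \<in> B \<and> (n = 0 \<longrightarrow> (\<forall>b\<in>B. b \<le> x))"
  let ?Q = "\<lambda>(n::nat) x y. y < x \<and> (\<forall>b\<in>B. b < x \<longrightarrow> b \<le> y)"
  have "\<exists>\<sigma>. \<forall>n. ?P n (\<sigma> n) \<and> ?Q n (\<sigma> n) (\<sigma> (Suc n))"
  proof (rule dependent_nat_choice)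
    have "B \<noteq> {}" using inf by auto
    then show "\<exists>x. ?P 0 x"
      by (metis locally_finite_pos_greatest[OF lf pos])
  next
    fix x and n :: nat
    assume x: "?P n x"
    have "{b \<in> B. b < x} \<noteq> {}"
    proof
      assume "{b \<in> B. b < x} = {}"
      then have "B \<subseteq> {b \<in> B. x / 2 < b}" using pos by fastforce
      moreover have "finite {b \<in> B. x / 2 < b}"
        using x pos by (intro locally_finite_posD[OF lf]) auto
      ultimately show False using inf finite_subset by blast
    qed
    then obtain y where "y \<in> {b \<in> B. b < x}" "\<And>b. b \<in> {b \<in> B. b < x} \<Longrightarrow> b \<le> y"
      using locally_finite_pos_greatest[of "{b \<in> B. b < x}"] lf pos
        locally_finite_pos_subset[OF lf, of "{b \<in> B. b < x}"] by blast
    then show "\<exists>y. ?P (Suc n) y \<and> ?Q n x y" by auto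
  qed
  then obtain \<sigma> where \<sigma>: "\<And>n. \<sigma> n \<in> B" "\<And>b. b \<in> B \<Longrightarrow> b \<le> \<sigma> 0" "\<And>n. \<sigma> (Suc n) < \<sigma> n"
      "\<And>n b. b \<in> B \<Longrightarrow> b < \<sigma> n \<Longrightarrow> b \<le> \<sigma> (Suc n)"
    by auto
  have less: "\<sigma> n < \<sigma> m" if "m < n" for m n
    using that lift_Suc_mono_less[of "\<lambda>n. - \<sigma> n"] \<sigma>(3) by simp
  have small: "\<exists>n. \<sigma> n \<le> \<epsilon>" if "\<epsilon> > 0" for \<epsilon>
  proof (rule ccontr)
    assume "\<nexists>n. \<sigma> n \<le> \<epsilon>"
    then have "range \<sigma> \<subseteq> {b \<in> B. \<epsilon> < b}" using \<sigma>(1) by (auto simp: not_le)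
    moreover have "infinite (range \<sigma>)"
      using less by (intro range_inj_infinite linorder_injI) (metis less_irrefl)
    ultimately show False
      using locally_finite_posD[OF lf that] finite_subset by blast
  qed
  have "\<sigma> \<longlonglongrightarrow> 0"
  proof (rule order_tendstoI)
    fix a :: real assume "0 < a"
    then obtain k where k: "\<sigma> k \<le> a" using small by blast
    have "\<sigma> n < a" if "Suc k \<le> n" for n
      using less[of k n] that k by linarith
    then show "\<forall>\<^sub>F n in sequentially. \<sigma> n < a"
      by (auto simp: eventually_sequentially)
  next
    fix a :: real assume "a < 0"
    moreover have "0 < \<sigma> n" for n using \<sigma>(1) pos by auto
    ultimately show "\<forall>\<^sub>F n in sequentially. a < \<sigma> n"
      by (intro always_eventually allI) (meson less_trans)
  qed
  moreover have "B \<subseteq> range \<sigma>"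
  proof
    fix b assume b: "b \<in> B"
    then have "\<exists>n. \<sigma> n \<le> b" using small pos by auto
    \<comment> \<open>By minimality \<open>n\<close> is 0 or \<open>b\<close> lies strictly below
      the preceding term; either way the choice of \<open>\<sigma> n\<close> as a greatest element
      gives \<open>b \<le> \<sigma> n\<close>.\<close>
    define n where "n = (LEAST n. \<sigma> n \<le> b)"
    have n: "\<sigma> n \<le> b"
      using \<open>\<exists>n. \<sigma> n \<le> b\<close> unfolding n_def by (rule LeastI_ex)
    have "b \<le> \<sigma> n"
    proof (cases n)
      case 0
      then show ?thesis using \<sigma>(2) b by simp
    next
      case (Suc m)
      then have "\<not> \<sigma> m \<le> b" using not_less_Least[of m "\<lambda>n. \<sigma> n \<le> b"] n_def by simp
      then show ?thesis using \<sigma>(4)[OF b, of m] Suc by simp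
    qed
    with n have "b = \<sigma> n" by simp
    then show "b \<in> range \<sigma>" by blast
  qed
  ultimately show thesis
    using \<sigma>(1) less by (intro that) (auto simp: monotone_on_def)
qed

section \<open>The carriers and the distance\<close>

lemma U_carrier_iff:
  assumes "S \<subseteq> {0<..}" "0 islimpt S"
  shows "x \<in> U_carrier S \<longleftrightarrow> x \<in> S \<rightarrow>\<^sub>E UNIV \<and> locally_finite_pos (supp_on S x)"
proof
  assume "x \<in> U_carrier S"
  then show "x \<in> S \<rightarrow>\<^sub>E UNIV \<and> locally_finite_pos (supp_on S x)"
    unfolding U_carrier_def by (blast intro: locally_finite_pos_subset locally_finite_pos_range)
next
  assume x: "x \<in> S \<rightarrow>\<^sub>E UNIV \<and> locally_finite_pos (supp_on S x)"
  \<comment> \<open>Joining \<open>B\<close> to the support makes the set infinite whether or not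
    the support is, so one enumeration serves both cases.\<close>
  obtain B where B: "B \<subseteq> S" "infinite B" "locally_finite_pos B"
    using islimpt_0_infinite_locally_finite_pos assms .
  have sub: "supp_on S x \<union> B \<subseteq> S" using B(1) by (auto simp: supp_on_def)
  have "locally_finite_pos (supp_on S x \<union> B)" "supp_on S x \<union> B \<subseteq> {0<..}" "infinite (supp_on S x \<union> B)"
    using x B sub assms(1) by (auto intro: locally_finite_pos_Un)
  then obtain \<sigma> :: "nat \<Rightarrow> real" where "range \<sigma> = supp_on S x \<union> B" "strict_antimono_on UNIV \<sigma>" "\<sigma> \<longlonglongrightarrow> 0"
    by (rule locally_finite_pos_enumerate)
  then show "x \<in> U_carrier S"
    unfolding U_carrier_def using x sub by blast
qed

lemma Q_carrier_subset_U_carrier: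
  assumes "S \<subseteq> {0<..}" "0 islimpt S"
  shows "Q_carrier S \<subseteq> U_carrier S"
  using U_carrier_iff[OF assms] finite_imp_locally_finite_pos by (auto simp: Q_carrier_def)

lemma sep_dist_eq_greatest:
  assumes "m \<in> S" "x m \<noteq> y m" "\<And>t. t \<in> S \<Longrightarrow> x t \<noteq> y t \<Longrightarrow> t \<le> m"
  shows "sep_dist S x y = m"
proof -
  have "(LEAST s. s \<in> S \<and> (\<forall>t\<in>S. s < t \<longrightarrow> x t = y t)) = m"
    by (rule Least_equality) (use assms in \<open>auto simp: not_le[symmetric]\<close>)
  then show ?thesis using assms(2) by (auto simp: sep_dist_def)
qed

text \<open>Trades the minimum for agreement above a radius, from which the metric properties are
  read off. The bound \<open>0 \<le> r\<close> matters when \<open>x = y\<close>: agreement then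
  holds for every \<open>r\<close>, but the distance is 0.\<close>

lemma U_dist_le_iff:
  assumes S: "S \<subseteq> {0<..}" "0 islimpt S" and x: "x \<in> U_carrier S" and y: "y \<in> U_carrier S"
    and r: "0 \<le> r"
  shows "U_dist S x y \<le> r \<longleftrightarrow> (\<forall>t\<in>S. r < t \<longrightarrow> x t = y t)"
proof (cases "x = y")
  case True
  then show ?thesis using r by (simp add: U_dist_def dist_on_def sep_dist_def)
next
  case False
  \<comment> \<open>Points of difference lie in the union of the two supports, so there is a
    greatest one, and it is the distance.\<close>
  let ?D = "{s \<in> S. x s \<noteq> y s}"
  have "locally_finite_pos (supp_on S x \<union> supp_on S y)"
    using x y by (simp add: U_carrier_iff[OF S] locally_finite_pos_Un)
  then have "locally_finite_pos ?D"
    by (rule locally_finite_pos_subset) (auto simp: supp_on_def)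
  moreover have "?D \<subseteq> {0<..}" using S(1) by auto
  moreover have "?D \<noteq> {}"
    using False x y PiE_ext[of x S "\<lambda>_. UNIV" y] by (auto simp: U_carrier_iff[OF S])
  ultimately obtain m where m: "m \<in> ?D" "\<And>a. a \<in> ?D \<Longrightarrow> a \<le> m"
    by (rule locally_finite_pos_greatest) blast
  then have "U_dist S x y = m"
    using x y sep_dist_eq_greatest[of m S x y] by (auto simp: U_dist_def dist_on_def)
  then show ?thesis using m by force
qed

lemma U_dist_nonneg:
  assumes S: "S \<subseteq> {0<..}" "0 islimpt S"
  shows "0 \<le> U_dist S x y"
proof (rule ccontr)
  assume neg: "\<not> 0 \<le> U_dist S x y"
  then have xy: "x \<in> U_carrier S" "y \<in> U_carrier S" "x \<noteq> y"
    by (auto simp: U_dist_def dist_on_def sep_dist_def split: if_splits)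
  have "\<forall>t\<in>S. x t = y t"
    using U_dist_le_iff[OF S xy(1,2), of 0] neg S(1) by auto
  then have "x = y"
    using xy PiE_ext[of x S "\<lambda>_. UNIV" y] by (auto simp: U_carrier_iff[OF S])
  with xy show False by simp
qed

section \<open>The ultrametric structure on both carriers\<close>

lemma Ultrametric_space_U:
  assumes S: "S \<subseteq> {0<..}" "0 islimpt S"
  shows "Ultrametric_space (U_carrier S) (U_dist S)"
proof -
  note le = U_dist_le_iff[OF S] and nonneg = U_dist_nonneg[OF S]
  have ultra: "U_dist S x z \<le> max (U_dist S x y) (U_dist S y z)"
    if "x \<in> U_carrier S" "y \<in> U_carrier S" "z \<in> U_carrier S" for x y z
  proof -
    \<comment> \<open>Above \<open>?r\<close> the function \<open>y\<close> agrees with both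
      \<open>x\<close> and \<open>z\<close>, so these agree with each other.\<close>
    let ?r = "max (U_dist S x y) (U_dist S y z)"
    have r: "0 \<le> ?r" using nonneg by (simp add: le_max_iff_disj)
    have "U_dist S x y \<le> ?r" "U_dist S y z \<le> ?r" by auto
    then show ?thesis using that r by (simp add: le del: max.cobounded1 max.cobounded2)
  qed
  show ?thesis
  proof
    fix x y
    show "0 \<le> U_dist S x y" by (rule nonneg)
    have "sep_dist S x y = sep_dist S y x" for x y
      by (simp add: sep_dist_def eq_commute)
    then show "U_dist S x y = U_dist S y x" by (simp add: U_dist_def dist_on_def)
  next
    fix x y assume xy: "x \<in> U_carrier S" "y \<in> U_carrier S"
    show "U_dist S x y = 0 \<longleftrightarrow> x = y"
    proof
      assume "U_dist S x y = 0"
      then have "\<forall>t\<in>S. x t = y t" using le[OF xy, of 0] S(1) by auto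
      then show "x = y"
        using xy PiE_ext[of x S "\<lambda>_. UNIV" y] by (auto simp: U_carrier_iff[OF S])
    qed (simp add: U_dist_def dist_on_def sep_dist_def)
  next
    fix x y z assume xyz: "x \<in> U_carrier S" "y \<in> U_carrier S" "z \<in> U_carrier S"
    show "U_dist S x z \<le> max (U_dist S x y) (U_dist S y z)"
      by (rule ultra[OF xyz])
    then show "U_dist S x z \<le> U_dist S x y + U_dist S y z"
      using nonneg[of x y] nonneg[of y z] by linarith
  qed
qed

lemma Q_dist_eq_U_dist:
  assumes "S \<subseteq> {0<..}" "0 islimpt S" "x \<in> Q_carrier S" "y \<in> Q_carrier S"
  shows "Q_dist S x y = U_dist S x y"
  using assms Q_carrier_subset_U_carrier[OF assms(1,2)]
  by (auto simp: Q_dist_def U_dist_def dist_on_def)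

lemma Ultrametric_space_Q:
  assumes S: "S \<subseteq> {0<..}" "0 islimpt S"
  shows "Ultrametric_space (Q_carrier S) (Q_dist S)"
proof -
  interpret U: Ultrametric_space "U_carrier S" "U_dist S"
    by (rule Ultrametric_space_U[OF S])
  note sub = subsetD[OF Q_carrier_subset_U_carrier[OF S]] and eq = Q_dist_eq_U_dist[OF S]
  have out: "Q_dist S x y = 0" if "x \<notin> Q_carrier S \<or> y \<notin> Q_carrier S" for x y
    using that by (auto simp: Q_dist_def dist_on_def)
  show ?thesis
  proof
    fix x y
    show "0 \<le> Q_dist S x y" by (metis eq out U.nonneg order_refl)
    show "Q_dist S x y = Q_dist S y x" by (metis eq out U.commute)
  qed (simp_all add: eq sub U.triangle U.ultrametric)
qed

section \<open>Completeness and density\<close>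

lemma mcomplete_U:
  assumes S: "S \<subseteq> {0<..}" "0 islimpt S"
  shows "Metric_space.mcomplete (U_carrier S) (U_dist S)"
proof -
  interpret U: Ultrametric_space "U_carrier S" "U_dist S"
    by (rule Ultrametric_space_U[OF S])
  note le = U_dist_le_iff[OF S]
  show ?thesis
    unfolding U.mcomplete_def
  proof (intro allI impI)
    fix \<xi> assume C: "U.MCauchy \<xi>"
    then have \<xi>: "\<xi> n \<in> U_carrier S" for n by (auto simp: U.MCauchy_def)
    have "\<forall>\<epsilon>>0. \<exists>N. \<forall>m\<ge>N. \<forall>n\<ge>N. \<forall>t\<in>S. \<epsilon> < t \<longrightarrow> \<xi> m t = \<xi> n t"
    proof (intro allI impI)
      fix \<epsilon> :: real assume \<epsilon>: "\<epsilon> > 0"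
      then obtain N where N: "\<And>m n. N \<le> m \<Longrightarrow> N \<le> n \<Longrightarrow> U_dist S (\<xi> m) (\<xi> n) < \<epsilon>"
        using C unfolding U.MCauchy_def by blast
      show "\<exists>N. \<forall>m\<ge>N. \<forall>n\<ge>N. \<forall>t\<in>S. \<epsilon> < t \<longrightarrow> \<xi> m t = \<xi> n t"
        using le[OF \<xi> \<xi> less_imp_le[OF \<epsilon>]] less_imp_le[OF N] by blast
    qed
    then obtain N where N: "\<And>\<epsilon> m n t. \<lbrakk>\<epsilon> > 0; N \<epsilon> \<le> m; N \<epsilon> \<le> n; t \<in> S; \<epsilon> < t\<rbrakk> \<Longrightarrow> \<xi> m t = \<xi> n t"
      by metis
    \<comment> \<open>Beyond stage \<open>N (s / 2)\<close> the value at \<open>s\<close> no longer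
      changes, since \<open>s / 2 < s\<close>.\<close>
    define y where "y = (\<lambda>s\<in>S. \<xi> (N (s / 2)) s)"
    have y: "\<xi> n t = y t" if "\<epsilon> > 0" "N \<epsilon> \<le> n" "t \<in> S" "\<epsilon> < t" for \<epsilon> n t
    proof -
      \<comment> \<open>A common later index links the threshold for \<open>\<epsilon>\<close> with
        the one used to define \<open>y t\<close>.\<close>
      let ?k = "max n (N (t / 2))"
      have "\<xi> n t = \<xi> ?k t" using that by (intro N[of \<epsilon>]) auto
      also have "\<dots> = \<xi> (N (t / 2)) t" using that by (intro N[of "t / 2"]) auto
      finally show ?thesis using that by (simp add: y_def)
    qed
    have "locally_finite_pos (supp_on S y)"
      unfolding locally_finite_pos_def
    proof (intro allI impI)
      fix \<epsilon> :: real assume \<epsilon>: "\<epsilon> > 0"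
      have "{a \<in> supp_on S y. \<epsilon> < a} = {a \<in> supp_on S (\<xi> (N \<epsilon>)). \<epsilon> < a}"
        using y[OF \<epsilon> order_refl] by (auto simp: supp_on_def)
      then show "finite {a \<in> supp_on S y. \<epsilon> < a}"
        using \<xi> \<epsilon> by (simp add: U_carrier_iff[OF S] locally_finite_posD)
    qed
    then have yU: "y \<in> U_carrier S" by (simp add: U_carrier_iff[OF S] y_def)
    have "limitin U.mtopology \<xi> y sequentially"
      unfolding U.limitin_metric eventually_sequentially
    proof (intro conjI allI impI)
      fix \<epsilon> :: real assume \<epsilon>: "\<epsilon> > 0"
      \<comment> \<open>Agreement above a radius yields only a weak inequality; using
        \<open>\<epsilon> / 2\<close> makes it strict.\<close>
      have "U_dist S (\<xi> n) y < \<epsilon>" if "N (\<epsilon> / 2) \<le> n" for n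
      proof -
        have "U_dist S (\<xi> n) y \<le> \<epsilon> / 2"
          using le[OF \<xi> yU, of "\<epsilon> / 2"] y[of "\<epsilon> / 2" n] that \<epsilon> by simp
        then show ?thesis using \<epsilon> by simp
      qed
      then show "\<exists>N. \<forall>n\<ge>N. \<xi> n \<in> U_carrier S \<and> U_dist S (\<xi> n) y < \<epsilon>" using \<xi> by blast
    qed (rule yU)
    then show "\<exists>x. limitin U.mtopology \<xi> x sequentially" by blast
  qed
qed

lemma Q_carrier_dense:
  assumes S: "S \<subseteq> {0<..}" "0 islimpt S" and x: "x \<in> U_carrier S" and \<epsilon>: "\<epsilon> > 0"
  shows "\<exists>y\<in>Q_carrier S. U_dist S x y \<le> \<epsilon>"
proof -
  define y where "y = (\<lambda>s\<in>S. if \<epsilon> < s then x s else 0)"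
  have "supp_on S y = {a \<in> supp_on S x. \<epsilon> < a}" by (auto simp: supp_on_def y_def)
  then have y: "y \<in> Q_carrier S"
    using x \<epsilon> by (simp add: Q_carrier_def y_def U_carrier_iff[OF S] locally_finite_posD)
  moreover have "U_dist S x y \<le> \<epsilon>"
    using U_dist_le_iff[OF S x, of y \<epsilon>] y Q_carrier_subset_U_carrier[OF S] \<epsilon> by (auto simp: y_def)
  ultimately show ?thesis by blast
qed

lemma is_completion_Q_U:
  assumes S: "S \<subseteq> {0<..}" "0 islimpt S"
  shows "is_completion (Q_carrier S) (Q_dist S) (U_carrier S) (U_dist S) (\<lambda>x. x)"
proof -
  interpret U: Ultrametric_space "U_carrier S" "U_dist S"
    by (rule Ultrametric_space_U[OF S])
  interpret Q: Ultrametric_space "Q_carrier S" "Q_dist S"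
    by (rule Ultrametric_space_Q[OF S])
  note sub = Q_carrier_subset_U_carrier[OF S]
  have "U.mtopology closure_of Q_carrier S = U_carrier S"
    unfolding U.metric_closure_of_alt using Q_carrier_dense[OF S] sub by fastforce
  then show ?thesis
    using sub mcomplete_U[OF S] Q_dist_eq_U_dist[OF S] U.Metric_space_axioms Q.Metric_space_axioms
    by (auto simp: is_completion_def isometric_embedding_def)
qed

section \<open>Uniqueness of completions\<close>

text \<open>
  Points of two completions of the same space correspond to each other if they are
  approximated by the same points of that space.
\<close>

definition completion_rel ::
  "'a set \<Rightarrow> ('b \<Rightarrow> 'b \<Rightarrow> real) \<Rightarrow> ('a \<Rightarrow> 'b) \<Rightarrow> ('c \<Rightarrow> 'c \<Rightarrow> real) \<Rightarrow> ('a \<Rightarrow> 'c) \<Rightarrow> 'b \<Rightarrow> 'c \<Rightarrow> bool" where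
  "completion_rel M e j u i p q \<longleftrightarrow> (\<forall>\<epsilon>>0. \<exists>x\<in>M. e (j x) p < \<epsilon> \<and> u (i x) q < \<epsilon>)"

lemma completion_rel_commute: "completion_rel M e j u i p q \<longleftrightarrow> completion_rel M u i e j q p"
  by (auto simp: completion_rel_def)

text \<open>Common approximants \<open>x\<close> and \<open>x'\<close> have the same distance in
  both completions, and it is close to both distances in question. This yields the isometry and, for
  \<open>p = p'\<close>, uniqueness of the partner.\<close>

lemma completion_rel_dist_eq:
  assumes N: "is_completion M d N e j" and U: "is_completion M d U u i"
    and p: "p \<in> N" "p' \<in> N" and q: "q \<in> U" "q' \<in> U"
    and rel: "completion_rel M e j u i p q" "completion_rel M e j u i p' q'"
  shows "u q q' = e p p'"
proof -
  interpret N: Metric_space N e using N by (simp add: is_completion_def)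
  interpret U: Metric_space U u using U by (simp add: is_completion_def)
  have "\<bar>u q q' - e p p'\<bar> \<le> \<epsilon>" if "\<epsilon> > 0" for \<epsilon>
  proof -
    \<comment> \<open>Four approximation errors enter, two in each completion.\<close>
    from that have "\<epsilon> / 4 > 0" by simp
    with rel obtain x x' where x: "x \<in> M" "e (j x) p < \<epsilon> / 4" "u (i x) q < \<epsilon> / 4"
      and x': "x' \<in> M" "e (j x') p' < \<epsilon> / 4" "u (i x') q' < \<epsilon> / 4"
      unfolding completion_rel_def by meson
    have mem: "j x \<in> N" "j x' \<in> N" "i x \<in> U" "i x' \<in> U"
      and eq: "e (j x) (j x') = u (i x) (i x')"
      using N U x(1) x'(1) by (auto simp: is_completion_def isometric_embedding_def)
    have "e p p' \<le> e p (j x) + e (j x) (j x') + e (j x') p'"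
      "e (j x) (j x') \<le> e (j x) p + e p p' + e p' (j x')"
      using N.triangle p mem by (meson add_right_mono order_trans)+
    moreover have "u q q' \<le> u q (i x) + u (i x) (i x') + u (i x') q'"
      "u (i x) (i x') \<le> u (i x) q + u q q' + u q' (i x')"
      using U.triangle q mem by (meson add_right_mono order_trans)+
    ultimately show ?thesis
      using x(2,3) x'(2,3) eq N.commute[of p "j x"] N.commute[of p' "j x'"]
        U.commute[of q "i x"] U.commute[of q' "i x'"] by linarith
  qed
  then have "\<bar>u q q' - e p p'\<bar> \<le> 0" by (rule field_le_epsilon) simp
  then show ?thesis by simp
qed

text \<open>Density gives points of \<open>M\<close> whose images under \<open>j\<close> tend to
  \<open>p\<close>. Their images under \<open>i\<close> have the same mutual distances, hence form a
  Cauchy sequence, whose limit is the partner of \<open>p\<close>.\<close>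

lemma completion_rel_total:
  assumes N: "is_completion M d N e j" and U: "is_completion M d U u i" and p: "p \<in> N"
  shows "\<exists>q\<in>U. completion_rel M e j u i p q"
proof -
  interpret N: Metric_space N e using N by (simp add: is_completion_def)
  interpret U: Metric_space U u using U by (simp add: is_completion_def)
  have j: "\<And>x. x \<in> M \<Longrightarrow> j x \<in> N" and i: "\<And>x. x \<in> M \<Longrightarrow> i x \<in> U"
    and eq: "\<And>x y. x \<in> M \<Longrightarrow> y \<in> M \<Longrightarrow> u (i x) (i y) = e (j x) (j y)"
    using N U by (auto simp: is_completion_def isometric_embedding_def)
  have "p \<in> N.mtopology closure_of (j ` M)" using N p by (simp add: is_completion_def)
  then have dense: "\<exists>x\<in>M. e (j x) p < r" if "r > 0" for r
    using that by (auto simp: N.metric_closure_of N.commute)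
  have "\<forall>n. \<exists>x\<in>M. e (j x) p < 1 / Suc n" by (intro allI dense) simp
  then obtain a where a: "\<And>n. a n \<in> M" "\<And>n. e (j (a n)) p < 1 / Suc n" by metis
  have small: "e (j (a n)) p < \<epsilon>" if "1 / Suc k < \<epsilon>" "k \<le> n" for \<epsilon> k n
  proof -
    have "1 / real (Suc n) \<le> 1 / real (Suc k)" using that(2) by (intro divide_left_mono) auto
    then show ?thesis using a(2)[of n] that(1) by linarith
  qed
  have "U.MCauchy (\<lambda>n. i (a n))"
    unfolding U.MCauchy_def
  proof (intro conjI allI impI)
    fix \<epsilon> :: real assume "\<epsilon> > 0"
    then obtain k where k: "1 / real (Suc k) < \<epsilon> / 2"
      using nat_approx_posE[of "\<epsilon> / 2"] by auto
    have "u (i (a m)) (i (a n)) < \<epsilon>" if "k \<le> m" "k \<le> n" for m n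
      using eq[OF a(1) a(1), of m n] N.triangle[OF j[OF a(1)] p j[OF a(1)], of m n]
        small[OF k that(1)] small[OF k that(2)] N.commute[of p "j (a n)"] by linarith
    then show "\<exists>N. \<forall>m n. N \<le> m \<longrightarrow> N \<le> n \<longrightarrow> u (i (a m)) (i (a n)) < \<epsilon>" by blast
  qed (use a i in auto)
  then obtain q where q: "limitin U.mtopology (\<lambda>n. i (a n)) q sequentially"
    using U by (auto simp: is_completion_def U.mcomplete_def)
  have "completion_rel M e j u i p q"
    unfolding completion_rel_def
  proof (intro allI impI)
    fix \<epsilon> :: real assume \<epsilon>: "\<epsilon> > 0"
    obtain k where k: "1 / real (Suc k) < \<epsilon>"
      using nat_approx_posE[OF \<epsilon>] by auto
    obtain m where m: "\<And>n. m \<le> n \<Longrightarrow> u (i (a n)) q < \<epsilon>"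
      using q \<epsilon> unfolding U.limitin_metric eventually_sequentially by blast
    \<comment> \<open>The index \<open>max k m\<close> is late enough for both approximations at
      once.\<close>
    show "\<exists>x\<in>M. e (j x) p < \<epsilon> \<and> u (i x) q < \<epsilon>"
      using a(1) small[OF k, of "max k m"] m[of "max k m"] by force
  qed
  then show ?thesis using q by (auto simp: U.limitin_metric)
qed

lemma completion_unique:
  assumes N: "is_completion M d N e j" and U: "is_completion M d U u i"
  shows "\<exists>h. bij_betw h N U \<and> isometric_embedding N e U u h \<and> (\<forall>x\<in>M. h (j x) = i x)"
proof -
  interpret N: Metric_space N e using N by (simp add: is_completion_def)
  interpret U: Metric_space U u using U by (simp add: is_completion_def)
  let ?R = "completion_rel M e j u i"
  obtain h where h: "\<And>p. p \<in> N \<Longrightarrow> h p \<in> U" "\<And>p. p \<in> N \<Longrightarrow> ?R p (h p)"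
    using completion_rel_total[OF N U] by metis
  \<comment> \<open>Pairing \<open>p\<close> with itself gives
    \<open>u (h p) q = e p p = 0\<close>.\<close>
  have uniq: "h p = q" if "p \<in> N" "q \<in> U" "?R p q" for p q
    using completion_rel_dist_eq[OF N U that(1) that(1) h(1)[OF that(1)] that(2) h(2)[OF that(1)] that(3)]
      that h by simp
  have iso: "u (h p) (h p') = e p p'" if "p \<in> N" "p' \<in> N" for p p'
    using completion_rel_dist_eq[OF N U] that h by blast
  have "inj_on h N"
    using iso h(1) by (intro inj_onI) (metis N.zero U.zero)
  \<comment> \<open>Surjectivity is totality of the relation with the two completions
    exchanged.\<close>
  moreover have "U \<subseteq> h ` N"
  proof
    fix q assume "q \<in> U"
    then obtain p where "p \<in> N" "?R p q"
      using completion_rel_total[OF U N] completion_rel_commute by metis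
    then show "q \<in> h ` N" using uniq \<open>q \<in> U\<close> by blast
  qed
  moreover have "h (j x) = i x" if "x \<in> M" for x
  proof (rule uniq)
    show mem: "j x \<in> N" "i x \<in> U"
      using N U that by (auto simp: is_completion_def isometric_embedding_def)
    \<comment> \<open>The point \<open>x\<close> itself approximates both sides with error
      0.\<close>
    show "?R (j x) (i x)"
      using mem that unfolding completion_rel_def by (metis N.zero U.zero)
  qed
  ultimately show ?thesis
    using h(1) iso by (intro exI[of _ h]) (auto simp: bij_betw_def isometric_embedding_def)
qed

theorem theorem8:
  fixes S :: "real set"
  assumes "S \<subseteq> {0<..}" and "countable S" and "0 islimpt S"
  shows "Ultrametric_space (Q_carrier S) (Q_dist S) \<and>
    Ultrametric_space (U_carrier S) (U_dist S) \<and>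
    is_completion (Q_carrier S) (Q_dist S) (U_carrier S) (U_dist S) (\<lambda>x. x) \<and>
    (\<forall>(N :: 'b set) e j. is_completion (Q_carrier S) (Q_dist S) N e j \<longrightarrow>
      (\<exists>h. bij_betw h N (U_carrier S) \<and> isometric_embedding N e (U_carrier S) (U_dist S) h \<and>
           (\<forall>x\<in>Q_carrier S. h (j x) = x)))"
  using Ultrametric_space_Q[OF assms(1,3)] Ultrametric_space_U[OF assms(1,3)]
    is_completion_Q_U[OF assms(1,3)] completion_unique[OF _ is_completion_Q_U[OF assms(1,3)]]
  by blast

end
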